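(* Let $\mu$ be a Borel probability measure on $\mathbb{C}$ that is symmetric with respect to the real line (i.e. $\mu(E)=\mu(\{\overline{z}:z\in E\})$ for every Borel set $E\subset\mathbb{C}$), and suppose that its potential $u_\mu$ satisfies $u_\mu(z)\le u_\mu(|z|)$ for all $z\in\mathbb{C}$. Then for every $\alpha\in(0,\pi/2)$, $$\mu\{z\in\mathbb{C}^*:|\mathrm{Arg}\, z|\le\alpha\}\le\frac{2\alpha}{\pi}.$$
   Context: $\mathbb{C}^*=\mathbb{C}\setminus\{0\}$, and $\mathrm{Arg}\, z\in(-\pi,\pi]$ is the principal argument of $z\in\mathbb{C}^*$. For a finite (positive Borel) measure $\mu$ on $\mathbb{C}$, its potential is the function $u_\mu:\mathbb{C}\to[-\infty,\infty)$, $$u_\mu(z)=\int_{|\zeta|\le1}\log|z-\zeta|\,d\mu(\zeta)+\int_{|\zeta|>1}\log\left|1-\frac{z}{\zeta}\right|d\mu(\zeta).$$ *)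

theory Defs
  imports "HOL-Probability.Probability"
begin

text \<open>Extended logarithm on \<open>[0, \<infinity>)\<close> with \<open>log 0 = - \<infinity>\<close>; the library's real \<open>ln\<close> has \<open>ln 0 = 0\<close>,
  which would make potentials wrong at the atoms of the measure.\<close>

definition elog :: "real \<Rightarrow> ereal" where
  "elog x = (if x = 0 then - \<infinity> else ereal (ln x))"

text \<open>The Lebesgue integral over \<open>A\<close> of an extended-real function, as the integral of the positive
  part minus that of the negative part (\<open>e2ennreal\<close> sends negative values to \<open>0\<close>). It is meaningful
  when at least one of the two is finite. The Bochner integral of the library would not do: it is \<open>0\<close>
  when the integral is \<open>- \<infinity>\<close>.\<close>

definition ext_set_integral :: "'a measure \<Rightarrow> 'a set \<Rightarrow> ('a \<Rightarrow> ereal) \<Rightarrow> ereal" where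
  "ext_set_integral M A f =
     enn2ereal (\<integral>\<^sup>+ x\<in>A. e2ennreal (f x) \<partial>M) - enn2ereal (\<integral>\<^sup>+ x\<in>A. e2ennreal (- f x) \<partial>M)"

text \<open>For a finite Borel measure both integrands are bounded above, by \<open>ln (1 + norm z)\<close>, so both
  integrals are well defined and less than \<open>\<infinity>\<close>, and no \<open>\<infinity> - \<infinity>\<close> occurs.\<close>

definition potential :: "complex measure \<Rightarrow> complex \<Rightarrow> ereal" where
  "potential \<mu> z =
     ext_set_integral \<mu> {\<zeta>. norm \<zeta> \<le> 1} (\<lambda>\<zeta>. elog (norm (z - \<zeta>)))
   + ext_set_integral \<mu> {\<zeta>. norm \<zeta> > 1} (\<lambda>\<zeta>. elog (norm (1 - z / \<zeta>)))"

end

(* Put \<zeta> = e^s cis p and z = e^x cis t. Up to a term independent of t, log|z - \<zeta>| equals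
   - W (x - s) (p - t), where W y t = ln ((cosh y + 1) / (cosh y - cos t)) / 2 is nonnegative and
   \<integral> W y t dy = (pi - |t|)^2 / 2 for |t| \<le> 2 pi: the derivative of W in t is minus half the
   Poisson-type kernel sin t / (cosh y - cos t), whose total mass is elementary. Integrating
   u(e^x cis t) \<le> u(e^x) over x with t = a and t = -a therefore gives
     \<integral> (pi - |p|)^2 d\<mu> \<le> \<integral> (pi - |p - a|)^2 / 2 + (pi - |p + a|)^2 / 2 d\<mu>,
   that is, 2 pi \<integral> max 0 (a - |p|) d\<mu> \<le> a^2 (Eremenko and Fryntov). With a = 2 \<alpha> the integrand on
   the left is at least \<alpha> on the sector |p| \<le> \<alpha>. *)
theory Submission
  imports Defs "HOL-Real_Asymp.Real_Asymp"
begin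

section \<open>Measurability of the argument; the logarithmic kernel\<close>

lemma borel_measurable_Arg [measurable]: "Arg \<in> borel_measurable borel"
proof -
  have "(\<lambda>z. if z \<in> {0} then 0 else if z \<in> \<real>\<^sub>\<le>\<^sub>0 then pi else Arg z) \<in> borel_measurable borel"
    by (intro measurable_If borel_measurable_continuous_on_if borel_measurable_const)
       (auto intro!: continuous_intros closed_nonpos_Reals_complex borel_closed)
  also have "(\<lambda>z. if z \<in> {0} then 0 else if z \<in> \<real>\<^sub>\<le>\<^sub>0 then pi else Arg z) = Arg"
  proof
    fix z :: complex
    have "Arg z = pi" if "z \<noteq> 0" "z \<in> \<real>\<^sub>\<le>\<^sub>0"
      using that by (auto simp: Arg_eq_pi complex_nonpos_Reals_iff complex_eq_iff)
    thus "(if z \<in> {0} then 0 else if z \<in> \<real>\<^sub>\<le>\<^sub>0 then pi else Arg z) = Arg z"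
      by (simp add: Arg_zero)
  qed
  finally show ?thesis .
qed

lemma cosh_real_gt_1: "1 < cosh y" if "y \<noteq> 0" for y :: real
proof -
  have "sinh y \<noteq> 0" using that by simp
  hence "cosh y ^ 2 > 1" by (simp add: cosh_square_eq)
  thus ?thesis using cosh_real_pos[of y] by (smt (verit) power_le_one)
qed

text \<open>At \<open>cosh y = cos t\<close>, where the potential has its logarithmic pole, division by zero makes this
  \<open>0\<close>; this shape keeps the kernel nonnegative everywhere.\<close>
definition log_kernel :: "real \<Rightarrow> real \<Rightarrow> real" where
  "log_kernel y t = ln (1 + (1 + cos t) / (cosh y - cos t)) / 2"

lemma cos_le_cosh: "cos t \<le> cosh (y :: real)"
  using cosh_real_ge_1[of y] cos_le_one[of t] by linarith

lemma log_kernel_nonneg: "0 \<le> log_kernel y t"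
proof -
  have "0 \<le> (1 + cos t) / (cosh y - cos t)"
    using cos_le_cosh[of t y] cos_ge_minus_one[of t] by (intro divide_nonneg_nonneg) linarith+
  thus ?thesis by (simp add: log_kernel_def)
qed

lemma measurable_log_kernel [measurable]:
  "(\<lambda>x. log_kernel (f x) (g x)) \<in> borel_measurable M"
  if [measurable]: "f \<in> borel_measurable M" "g \<in> borel_measurable M"
proof -
  have "cosh \<in> borel_measurable (borel :: real measure)"
    by (intro borel_measurable_continuous_onI continuous_intros)
  from measurable_compose[OF that(1) this]
  show ?thesis unfolding log_kernel_def by measurable
qed

lemma log_kernel_eq:
  assumes "y \<noteq> 0"
  shows "log_kernel y t = (ln (cosh y + 1) - ln (cosh y - cos t)) / 2"
proof -
  have "cosh y - cos t > 0" using cosh_real_gt_1[OF assms] cos_le_one[of t] by linarith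
  hence "1 + (1 + cos t) / (cosh y - cos t) = (cosh y + 1) / (cosh y - cos t)"
    by (simp add: field_simps)
  moreover have "cosh y + 1 > 0" using cosh_real_pos[of y] by linarith
  ultimately show ?thesis using \<open>cosh y - cos t > 0\<close>
    by (simp add: log_kernel_def ln_div)
qed

text \<open>The denominator is smallest at angle \<open>0\<close>, which yields a majorant
  independent of the angle. It breaks down at \<open>y = 0\<close>, where
  \<open>log_kernel 0 0\<close> takes the default value \<open>0\<close>.\<close>

lemma log_kernel_le: "log_kernel y t \<le> log_kernel y 0" if "y \<noteq> 0"
proof -
  have "cosh y - 1 > 0" "cosh y - 1 \<le> cosh y - cos t" using cosh_real_gt_1[OF that] cos_le_one[of t] by auto
  hence "ln (cosh y - 1) \<le> ln (cosh y - cos t)" by (subst ln_le_cancel_iff) linarith+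
  thus ?thesis using that by (simp add: log_kernel_eq)
qed

lemma log_kernel_minus: "log_kernel y (- t) = log_kernel y t"
  by (simp add: log_kernel_def)

lemma log_kernel_reflect: "log_kernel y (2 * pi - t) = log_kernel y t"
  by (simp add: log_kernel_def cos_diff)

section \<open>Integral of the kernel over the radial variable\<close>

text \<open>Substituting \<open>u = exp y\<close> gives the Poisson kernel of the half-plane,
  \<open>sin t / ((u - cos t)^2 + (sin t)^2)\<close>, whose antiderivative is an arctangent; over
  \<open>u > 0\<close> it rises from \<open>t - pi / 2\<close> to \<open>pi / 2\<close>.\<close>

lemma nn_integral_poisson_kernel:
  assumes "0 < t" "t < pi"
  shows "(\<integral>\<^sup>+ y. ennreal (sin t / (2 * (cosh y - cos t))) \<partial>lborel) = ennreal (pi - t)"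
proof -
  have s: "sin t > 0" using assms by (simp add: sin_gt_zero)
  define F where "F = (\<lambda>y. arctan ((exp y - cos t) / sin t))"
  have pos: "cosh y - cos t > 0" for y :: real
  proof -
    have "cos t < cos 0" using assms by (intro cos_monotone_0_pi) auto
    thus ?thesis using cosh_real_ge_1[of y] by simp
  qed
  have dF: "(F has_real_derivative sin t / (2 * (cosh y - cos t))) (at y)" for y
  proof -
    have sc: "sin t ^ 2 = 1 - cos t ^ 2" by (simp add: sin_squared_eq)
    have q: "exp y ^ 2 + 1 - 2 * exp y * cos t = 2 * exp y * (cosh y - cos t)"
      by (simp add: cosh_def field_simps exp_minus power2_eq_square)
    have "(F has_real_derivative (exp y / sin t) / (1 + ((exp y - cos t) / sin t)\<^sup>2)) (at y)"
      unfolding F_def using s by (auto intro!: derivative_eq_intros simp: divide_inverse)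
    also have "(exp y / sin t) / (1 + ((exp y - cos t) / sin t)\<^sup>2)
        = exp y * sin t / (sin t ^ 2 + (exp y - cos t) ^ 2)"
      using s by (simp add: field_simps power2_eq_square)
    also have "sin t ^ 2 + (exp y - cos t) ^ 2 = 2 * exp y * (cosh y - cos t)"
      unfolding q[symmetric] sc by (simp add: power2_eq_square algebra_simps)
    also have "exp y * sin t / \<dots> = sin t / (2 * (cosh y - cos t))" by simp
    finally show ?thesis .
  qed
  have "(F \<longlongrightarrow> arctan ((0 - cos t) / sin t)) at_bot"
    unfolding F_def using s by (intro tendsto_intros exp_at_bot) auto
  \<comment> \<open>The shift by \<open>pi / 2\<close> puts the angle into the interval where
    \<open>arctan\<close> inverts \<open>tan\<close>.\<close>
  also have "(0 - cos t) / sin t = tan (t - pi / 2)"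
    by (simp add: tan_def sin_diff cos_diff)
  also have "arctan \<dots> = t - pi / 2"
    using assms by (intro arctan_tan) auto
  finally have bot: "(F \<longlongrightarrow> t - pi / 2) at_bot" .
  have "filterlim (\<lambda>y. (exp y - cos t) / sin t) at_top at_top"
    using s by real_asymp
  hence top: "(F \<longlongrightarrow> pi / 2) at_top"
    unfolding F_def by (rule filterlim_compose[OF tendsto_arctan_at_top])
  let ?f = "\<lambda>y. sin t / (2 * (cosh y - cos t))"
  have nonneg: "0 \<le> ?f y" for y using s pos[of y] by (intro divide_nonneg_pos) auto
  have cont: "isCont ?f y" for y
    using pos[of y] by (intro continuous_intros) auto
  note FTC = interval_integral_FTC_nonneg[of "-\<infinity>" "\<infinity>" F ?f "t - pi / 2" "pi / 2"]
  have "set_integrable lborel (einterval (-\<infinity>) \<infinity>) ?f"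
    by (rule FTC) (use dF cont nonneg bot top in \<open>auto simp: ereal_tendsto_simps\<close>)
  moreover have "(LBINT y=-\<infinity>..\<infinity>. ?f y) = pi / 2 - (t - pi / 2)"
    by (rule FTC) (use dF cont nonneg bot top in \<open>auto simp: ereal_tendsto_simps\<close>)
  ultimately have "integrable lborel ?f" "integral\<^sup>L lborel ?f = pi - t"
    by (simp_all add: set_integrable_def interval_lebesgue_integral_def set_lebesgue_integral_def)
  thus ?thesis using nonneg by (simp add: nn_integral_eq_integral)
qed

text \<open>The kernel vanishes at \<open>t = pi\<close>, so it is the integral over
  \<open>{t..pi}\<close> of minus its angular derivative. Tonelli and
  \<open>nn_integral_poisson_kernel\<close> reduce the claim to integrating
  \<open>pi - s\<close>.\<close>

lemma nn_integral_log_kernel_0_pi: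
  assumes "0 \<le> t" "t \<le> pi"
  shows "(\<integral>\<^sup>+ y. ennreal (log_kernel y t) \<partial>lborel) = ennreal ((pi - t)\<^sup>2 / 2)"
proof -
  let ?P = "\<lambda>y s. ennreal (sin s / (2 * (cosh y - cos s))) * indicator {t..pi} s"
  have [measurable]: "cosh \<in> borel_measurable (borel :: real measure)"
    by (intro borel_measurable_continuous_onI continuous_intros)
  have *: "ennreal (log_kernel y t) = (\<integral>\<^sup>+ s. ?P y s \<partial>lborel)" if "y \<noteq> 0" for y
  proof -
    have pos: "cosh y - cos s > 0" for s
      using cosh_real_gt_1[OF that] cos_le_one[of s] by linarith
    have "(\<integral>\<^sup>+ s. ?P y s \<partial>lborel) = ennreal (ln (cosh y - cos pi) / 2 - ln (cosh y - cos t) / 2)"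
    proof (rule nn_integral_FTC_Icc)
      show "((\<lambda>s. ln (cosh y - cos s) / 2) has_real_derivative sin s / (2 * (cosh y - cos s))) (at s)" for s
        using pos[of s] by (auto intro!: derivative_eq_intros simp: field_simps)
      show "0 \<le> sin s / (2 * (cosh y - cos s))" if "s \<in> {t..pi}" for s
        using pos[of s] that assms by (intro divide_nonneg_pos sin_ge_zero) auto
    qed (use assms in auto)
    thus ?thesis using that by (simp add: log_kernel_eq diff_divide_distrib)
  qed
  have "(\<integral>\<^sup>+ y. ennreal (log_kernel y t) \<partial>lborel) = (\<integral>\<^sup>+ y. \<integral>\<^sup>+ s. ?P y s \<partial>lborel \<partial>lborel)"
    by (intro nn_integral_cong_AE eventually_mono[OF AE_lborel_singleton[of 0]] *)
  also have "\<dots> = (\<integral>\<^sup>+ s. \<integral>\<^sup>+ y. ?P y s \<partial>lborel \<partial>lborel)"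
    by (rule lborel_pair.Fubini'[symmetric]) measurable
  also have "\<dots> = (\<integral>\<^sup>+ s. ennreal (pi - s) * indicator {t..pi} s \<partial>lborel)"
  proof (intro nn_integral_cong_AE)
    \<comment> \<open>The angles \<open>0\<close> and \<open>pi\<close> are discarded as null: at
      \<open>s = 0\<close> the sine, and with it the inner integral, is \<open>0\<close> instead of
      \<open>pi\<close>.\<close>
    show "AE s in lborel. (\<integral>\<^sup>+ y. ?P y s \<partial>lborel) = ennreal (pi - s) * indicator {t..pi} s"
      using AE_lborel_singleton[of 0] AE_lborel_singleton[of pi]
    proof eventually_elim
      case (elim s)
      show ?case
      proof (cases "s \<in> {t..pi}")
        case True
        with elim assms have "0 < s" "s < pi" by auto
        from nn_integral_poisson_kernel[OF this] True show ?thesis by simp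
      qed auto
    qed
  qed
  also have "\<dots> = ennreal (- (pi - pi)\<^sup>2 / 2 - (- (pi - t)\<^sup>2 / 2))"
  proof (rule nn_integral_FTC_Icc)
    show "((\<lambda>s. - (pi - s)\<^sup>2 / 2) has_real_derivative pi - s) (at s)" for s
      by (rule derivative_eq_intros refl | simp)+
  qed (use assms in auto)
  finally show ?thesis by simp
qed

text \<open>Evenness and reflection at \<open>pi\<close> reduce to angles in \<open>[0, pi]\<close>,
  and \<open>(pi - \<bar>t\<bar>)\<^sup>2\<close> respects both. Differences of two arguments
  require the range up to \<open>2 * pi\<close>.\<close>

lemma nn_integral_log_kernel:
  assumes "\<bar>t\<bar> \<le> 2 * pi"
  shows "(\<integral>\<^sup>+ y. ennreal (log_kernel y t) \<partial>lborel) = ennreal ((pi - \<bar>t\<bar>)\<^sup>2 / 2)"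
proof -
  have abs: "log_kernel y t = log_kernel y \<bar>t\<bar>" for y
    by (cases "t \<ge> 0") (simp_all add: log_kernel_minus)
  show ?thesis
  proof (cases "\<bar>t\<bar> \<le> pi")
    case True
    thus ?thesis by (simp add: abs nn_integral_log_kernel_0_pi)
  next
    case False
    have "log_kernel y t = log_kernel y (2 * pi - \<bar>t\<bar>)" for y
      by (simp add: abs log_kernel_reflect)
    moreover have "(pi - (2 * pi - \<bar>t\<bar>))\<^sup>2 = (pi - \<bar>t\<bar>)\<^sup>2"
      by (simp add: power2_eq_square algebra_simps)
    ultimately show ?thesis
      using False assms by (simp add: nn_integral_log_kernel_0_pi)
  qed
qed


section \<open>The potential in logarithmic polar coordinates\<close>

text \<open>Away from the pole, the amount by which ln |z - \<zeta>|, for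
  \<open>z = exp x * cis t\<close>, lies below its maximum \<open>ln (exp x + norm \<zeta>)\<close>
  on the circle of radius \<open>exp x\<close>. For \<zeta> = 0 the logarithm is constant there,
  hence the value \<open>0\<close>.\<close>

definition polar_kernel :: "real \<Rightarrow> real \<Rightarrow> complex \<Rightarrow> real" where
  "polar_kernel t x \<zeta> = (if \<zeta> = 0 then 0 else log_kernel (x - ln (norm \<zeta>)) (Arg \<zeta> - t))"

text \<open>The part of the integrand of the potential at \<open>exp x * cis t\<close> that does not depend on \<open>t\<close>. The
  summand \<open>- ln (max 1 (norm \<zeta>))\<close> is the normalisation of the integrand outside the unit disc.\<close>
definition radial_part :: "real \<Rightarrow> complex \<Rightarrow> real" where
  "radial_part x \<zeta> = ln (exp x + norm \<zeta>) - ln (max 1 (norm \<zeta>))"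

lemma polar_kernel_nonneg: "0 \<le> polar_kernel t x \<zeta>"
  by (simp add: polar_kernel_def log_kernel_nonneg)

lemma measurable_polar_kernel [measurable]:
  "(\<lambda>w. polar_kernel t (f w) (g w)) \<in> borel_measurable M"
  if [measurable]: "f \<in> borel_measurable M" "g \<in> borel_measurable M"
  unfolding polar_kernel_def by measurable

lemma polar_kernel_le:
  assumes "norm \<zeta> \<noteq> exp x"
  shows "polar_kernel t x \<zeta> \<le> log_kernel (x - ln (norm \<zeta>)) 0"
proof (cases "\<zeta> = 0")
  case False
  hence "x - ln (norm \<zeta>) \<noteq> 0" using assms by auto
  thus ?thesis using False by (simp add: polar_kernel_def log_kernel_le)
qed (simp add: polar_kernel_def log_kernel_nonneg)

text \<open>Law of cosines: with \<open>y = x - ln r\<close>, the squared distance is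
  \<open>2 * exp x * r * (cosh y - cos p)\<close>, and \<open>(exp x + r)^2\<close> is the same
  expression with \<open>cosh y + 1\<close> as last factor. The logarithm of their quotient is twice
  the kernel.\<close>

lemma ln_norm_diff_polar:
  assumes "norm \<zeta> \<noteq> exp x"
  shows "norm (of_real (exp x) * cis t - \<zeta>) \<noteq> 0"
    and "ln (norm (of_real (exp x) * cis t - \<zeta>)) = ln (exp x + norm \<zeta>) - polar_kernel t x \<zeta>"
proof -
  let ?z = "of_real (exp x) * cis t"
  show nz: "norm (?z - \<zeta>) \<noteq> 0" using assms by (auto simp: norm_mult)
  show "ln (norm (?z - \<zeta>)) = ln (exp x + norm \<zeta>) - polar_kernel t x \<zeta>"
  proof (cases "\<zeta> = 0")
    case True
    thus ?thesis by (simp add: polar_kernel_def norm_mult)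
  next
    case False
    define r where "r = norm \<zeta>"
    define p where "p = Arg \<zeta> - t"
    define y where "y = x - ln r"
    have r: "r > 0" using False by (simp add: r_def)
    have y: "y \<noteq> 0" using assms r by (auto simp: y_def r_def)
    have z: "\<zeta> = of_real r * cis (Arg \<zeta>)" by (simp add: r_def cis_Arg False sgn_eq)
    have cosh: "2 * exp x * r * cosh y = exp x ^ 2 + r ^ 2"
      using r by (simp add: y_def cosh_def exp_diff exp_minus field_simps power2_eq_square)
    have square_expand: "(A * c - r * C)\<^sup>2 + (A * s - r * S)\<^sup>2
        = A\<^sup>2 * (s\<^sup>2 + c\<^sup>2) + r\<^sup>2 * (S\<^sup>2 + C\<^sup>2) - 2 * A * r * (C * c + S * s)" for A C S c s :: real
      by (simp add: power2_eq_square algebra_simps)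
    have "norm (?z - \<zeta>) ^ 2 = (exp x * cos t - r * cos (Arg \<zeta>))\<^sup>2 + (exp x * sin t - r * sin (Arg \<zeta>))\<^sup>2"
      by (subst z) (simp add: cmod_power2)
    also have "\<dots> = exp x ^ 2 * ((sin t)\<^sup>2 + (cos t)\<^sup>2) + r ^ 2 * ((sin (Arg \<zeta>))\<^sup>2 + (cos (Arg \<zeta>))\<^sup>2)
        - 2 * exp x * r * cos p"
      unfolding p_def cos_diff by (rule square_expand)
    also have "\<dots> = 2 * exp x * r * (cosh y - cos p)"
      by (simp only: right_diff_distrib cosh sin_cos_squared_add mult_1_right)
    finally have 1: "norm (?z - \<zeta>) ^ 2 = 2 * exp x * r * (cosh y - cos p)" .
    have "(exp x + r) ^ 2 = 2 * exp x * r * (cosh y + 1)"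
      by (simp only: distrib_left cosh) (simp add: power2_eq_square algebra_simps)
    hence "ln ((exp x + r) ^ 2) = ln (2 * exp x * r) + ln (cosh y + 1)"
      using r cosh_real_pos[of y] by (simp only: ln_mult_pos[of "2 * exp x * r" "cosh y + 1"] add_pos_pos
        mult_pos_pos zero_less_numeral exp_gt_zero zero_less_one)
    moreover have "ln (norm (?z - \<zeta>) ^ 2) = ln (2 * exp x * r) + ln (cosh y - cos p)"
    proof -
      have "cosh y - cos p > 0" using cosh_real_gt_1[OF y] cos_le_one[of p] by linarith
      thus ?thesis unfolding 1 using r by (subst ln_mult_pos) auto
    qed
    moreover have "2 * log_kernel y p = ln (cosh y + 1) - ln (cosh y - cos p)"
      by (simp add: log_kernel_eq[OF y])
    ultimately have "2 * ln (norm (?z - \<zeta>)) = 2 * ln (exp x + r) - 2 * log_kernel y p"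
      using r nz by (simp add: ln_realpow add_pos_pos)
    thus ?thesis using False by (simp add: polar_kernel_def y_def p_def r_def)
  qed
qed

lemma elog_norm_diff_polar:
  assumes "norm \<zeta> \<noteq> exp x" "norm \<zeta> \<le> 1"
  shows "elog (norm (of_real (exp x) * cis t - \<zeta>)) = ereal (radial_part x \<zeta> - polar_kernel t x \<zeta>)"
  using ln_norm_diff_polar[OF assms(1), of t] assms(2) by (simp add: elog_def radial_part_def)

lemma elog_norm_quotient_polar:
  assumes "norm \<zeta> \<noteq> exp x" "norm \<zeta> > 1"
  shows "elog (norm (1 - of_real (exp x) * cis t / \<zeta>)) = ereal (radial_part x \<zeta> - polar_kernel t x \<zeta>)"
proof -
  let ?z = "of_real (exp x) * cis t"
  have "\<zeta> \<noteq> 0" using assms by auto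
  hence "1 - ?z / \<zeta> = (\<zeta> - ?z) / \<zeta>" by (simp add: diff_divide_distrib)
  hence eq: "norm (1 - ?z / \<zeta>) = norm (?z - \<zeta>) / norm \<zeta>"
    by (simp only: norm_divide norm_minus_commute)
  have "ln (norm (?z - \<zeta>) / norm \<zeta>) = ln (norm (?z - \<zeta>)) - ln (norm \<zeta>)"
    using ln_norm_diff_polar(1)[OF assms(1), of t] \<open>\<zeta> \<noteq> 0\<close> by (simp add: ln_div)
  thus ?thesis
    unfolding eq using ln_norm_diff_polar[OF assms(1), of t] assms(2) \<open>\<zeta> \<noteq> 0\<close>
    by (simp add: elog_def radial_part_def)
qed

text \<open>Integrability of \<open>g\<close> makes the integrals of both parts finite, so the
  difference is an ordinary subtraction; infinite values of \<open>f\<close> on \<open>A\<close> are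
  confined to a null set.\<close>

lemma ext_set_integral_eq_set_integral:
  assumes "set_integrable M A g" and "AE x in M. x \<in> A \<longrightarrow> f x = ereal (g x)"
  shows "ext_set_integral M A f = ereal (set_lebesgue_integral M A g)"
proof -
  let ?g = "\<lambda>x. indicator A x * g x"
  have int: "integrable M ?g" using assms(1) by (simp add: set_integrable_def)
  have 1: "(\<integral>\<^sup>+ x\<in>A. e2ennreal (f x) \<partial>M) = (\<integral>\<^sup>+ x. ennreal (?g x) \<partial>M)"
    by (intro nn_integral_cong_AE eventually_mono[OF assms(2)]) (auto simp: indicator_def)
  have 2: "(\<integral>\<^sup>+ x\<in>A. e2ennreal (- f x) \<partial>M) = (\<integral>\<^sup>+ x. ennreal (- ?g x) \<partial>M)"
    by (intro nn_integral_cong_AE eventually_mono[OF assms(2)]) (auto simp: indicator_def)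
  have fin: "(\<integral>\<^sup>+ x. ennreal (?g x) \<partial>M) \<noteq> \<infinity>" "(\<integral>\<^sup>+ x. ennreal (- ?g x) \<partial>M) \<noteq> \<infinity>"
    using int by (simp_all add: real_integrable_def)
  have conv: "enn2ereal a - enn2ereal b = ereal (enn2real a - enn2real b)"
    if "a \<noteq> \<infinity>" "b \<noteq> \<infinity>" for a b
    using that by (cases a rule: ennreal_cases; cases b rule: ennreal_cases) auto
  show ?thesis
    unfolding ext_set_integral_def 1 2 conv[OF fin]
    by (simp add: set_lebesgue_integral_def real_lebesgue_integral_def[OF int])
qed

text \<open>With \<open>m = max 1 (norm \<zeta>)\<close>, the sum
  \<open>exp x + norm \<zeta>\<close> lies between \<open>exp (- \<bar>x\<bar>) * m\<close> and
  \<open>(1 + exp x) * m\<close>. So the normalisation keeps the radial part bounded in \<zeta>,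
  however heavy the tail of \<mu>.\<close>

lemma integrable_radial_part:
  assumes "finite_measure \<mu>" and "sets \<mu> = sets borel"
  shows "integrable \<mu> (radial_part x)"
proof (rule finite_measure.integrable_const_bound[where B = "ln (1 + exp x) + \<bar>x\<bar>"])
  show "finite_measure \<mu>" by fact
  note [measurable_cong] = assms(2)
  show "radial_part x \<in> borel_measurable \<mu>" unfolding radial_part_def[abs_def] by measurable
  show "AE \<zeta> in \<mu>. norm (radial_part x \<zeta>) \<le> ln (1 + exp x) + \<bar>x\<bar>"
  proof (rule AE_I2)
    fix \<zeta> :: complex
    define m where "m = max 1 (norm \<zeta>)"
    have m: "m \<ge> 1" "norm \<zeta> \<le> m" by (auto simp: m_def)
    have pos: "exp x + norm \<zeta> > 0" by (simp add: add_pos_nonneg)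
    have "exp x + norm \<zeta> \<le> (1 + exp x) * m"
      using m mult_left_mono[of 1 m "exp x"] by (simp add: algebra_simps add_mono)
    hence "ln (exp x + norm \<zeta>) \<le> ln ((1 + exp x) * m)"
      using pos m by (subst ln_le_cancel_iff) (auto simp: add_pos_pos intro!: mult_pos_pos)
    also have "\<dots> = ln (1 + exp x) + ln m"
      using m by (subst ln_mult_pos) (auto simp: add_pos_pos)
    finally have upper: "radial_part x \<zeta> \<le> ln (1 + exp x)" by (simp add: radial_part_def m_def)
    have "exp (- \<bar>x\<bar>) * m \<le> exp x + norm \<zeta>"
    proof (cases "norm \<zeta> \<le> 1")
      case True
      hence "exp (- \<bar>x\<bar>) * m \<le> exp x" by (simp add: m_def)
      thus ?thesis using norm_ge_zero[of \<zeta>] by linarith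
    next
      case False
      hence "exp (- \<bar>x\<bar>) * m \<le> 1 * norm \<zeta>"
        unfolding m_def by (intro mult_mono) auto
      thus ?thesis using exp_gt_zero[of x] by linarith
    qed
    hence "ln (exp (- \<bar>x\<bar>) * m) \<le> ln (exp x + norm \<zeta>)"
      using pos m by (subst ln_le_cancel_iff) auto
    moreover have "ln (exp (- \<bar>x\<bar>) * m) = - \<bar>x\<bar> + ln m"
      using m by (subst ln_mult_pos) auto
    ultimately have "- \<bar>x\<bar> \<le> radial_part x \<zeta>" by (simp add: radial_part_def m_def)
    moreover have "0 \<le> ln (1 + exp x)" by (intro ln_ge_zero) auto
    ultimately show "norm (radial_part x \<zeta>) \<le> ln (1 + exp x) + \<bar>x\<bar>"
      using upper unfolding real_norm_def by linarith
  qed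
qed

text \<open>Once the circle of radius \<open>exp x\<close> is null, the integrands inside and
  outside the unit disc agree almost everywhere with one real function, and the two integrals
  merge.\<close>

lemma potential_polar:
  assumes "finite_measure \<mu>" and sets: "sets \<mu> = sets borel"
    and AE: "AE \<zeta> in \<mu>. norm \<zeta> \<noteq> exp x"
    and int: "integrable \<mu> (polar_kernel t x)"
  shows "potential \<mu> (of_real (exp x) * cis t) =
    ereal (integral\<^sup>L \<mu> (radial_part x) - integral\<^sup>L \<mu> (polar_kernel t x))"
proof -
  let ?g = "\<lambda>\<zeta>. radial_part x \<zeta> - polar_kernel t x \<zeta>"
  let ?A = "{\<zeta>::complex. norm \<zeta> \<le> 1}" and ?B = "{\<zeta>::complex. norm \<zeta> > 1}"
  have [measurable]: "?A \<in> sets \<mu>" "?B \<in> sets \<mu>" unfolding sets by measurable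
  note rad = integrable_radial_part[OF assms(1) sets, of x]
  have g: "integrable \<mu> ?g" using int rad by simp
  have iA: "set_integrable \<mu> ?A ?g" and iB: "set_integrable \<mu> ?B ?g"
    unfolding set_integrable_def by (intro integrable_mult_indicator g; measurable)+
  have "potential \<mu> (of_real (exp x) * cis t)
      = ereal (set_lebesgue_integral \<mu> ?A ?g) + ereal (set_lebesgue_integral \<mu> ?B ?g)"
    unfolding potential_def
  proof (intro arg_cong2[where f = "(+)"] ext_set_integral_eq_set_integral iA iB)
  qed (use AE in eventually_elim, simp add: elog_norm_diff_polar elog_norm_quotient_polar)+
  also have "\<dots> = ereal (set_lebesgue_integral \<mu> (?A \<union> ?B) ?g)"
    using iA iB by (subst set_integral_Un) auto
  also have "?A \<union> ?B = UNIV" by auto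
  also have "set_lebesgue_integral \<mu> UNIV ?g = integral\<^sup>L \<mu> (radial_part x) - integral\<^sup>L \<mu> (polar_kernel t x)"
    using int rad by (simp add: set_lebesgue_integral_def)
  finally show ?thesis .
qed

section \<open>Exceptional radii and interchange of integrals\<close>

text \<open>A nonzero \<zeta> excludes only \<open>x = ln (norm \<zeta>)\<close>; Fubini exchanges
  the quantifiers. Thus almost every circle about the origin has no mass, even if \<mu> has
  atoms.\<close>

lemma AE_norm_ne_exp:
  assumes "sigma_finite_measure \<mu>" and "sets \<mu> = sets borel"
  shows "AE x in lborel. AE \<zeta> in \<mu>. norm (\<zeta> :: complex) \<noteq> exp x"
proof -
  interpret sigma_finite_measure \<mu> by fact
  interpret pair_sigma_finite lborel \<mu> ..
  note [measurable_cong] = assms(2)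
  have "AE x in lborel. norm \<zeta> \<noteq> exp x" for \<zeta> :: complex
    using AE_lborel_singleton[of "ln (norm \<zeta>)"] by eventually_elim auto
  moreover have "{p \<in> space (lborel \<Otimes>\<^sub>M \<mu>). norm (snd p) \<noteq> exp (fst p)} \<in> sets (lborel \<Otimes>\<^sub>M \<mu>)"
    by measurable
  ultimately show ?thesis by (subst AE_commute) auto
qed

lemma nn_integral_log_kernel_shift:
  assumes "\<bar>t\<bar> \<le> 2 * pi"
  shows "(\<integral>\<^sup>+ x. ennreal (log_kernel (x - c) t) \<partial>lborel) = ennreal ((pi - \<bar>t\<bar>)\<^sup>2 / 2)"
  using nn_integral_log_kernel[OF assms]
    nn_integral_real_affine[of "\<lambda>y. ennreal (log_kernel y t)" 1 "- c"]
  by simp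

lemma nn_integral_polar_kernel:
  assumes "\<bar>t\<bar> \<le> pi"
  shows "(\<integral>\<^sup>+ x. ennreal (polar_kernel t x \<zeta>) \<partial>lborel)
    = ennreal (indicator (- {0}) \<zeta> * ((pi - \<bar>Arg \<zeta> - t\<bar>)\<^sup>2 / 2))"
proof (cases "\<zeta> = 0")
  case False
  have "\<bar>Arg \<zeta> - t\<bar> \<le> 2 * pi" using Arg_bounded[of \<zeta>] assms by linarith
  thus ?thesis using False by (simp add: polar_kernel_def nn_integral_log_kernel_shift)
qed (simp add: polar_kernel_def)

text \<open>The exceptional set of \<open>x\<close> must serve all angles at once, because two
  angles are compared on the same circle. The angle-free majorant achieves this: its double integral
  is \<open>pi\<^sup>2 / 2\<close> times the total mass.\<close>

lemma AE_integrable_polar_kernel: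
  assumes "finite_measure \<mu>" and sets: "sets \<mu> = sets borel"
  shows "AE x in lborel. \<forall>t. integrable \<mu> (polar_kernel t x)"
proof -
  interpret finite_measure \<mu> by fact
  interpret pair_sigma_finite lborel \<mu> ..
  have sf: "sigma_finite_measure \<mu>" by unfold_locales
  note [measurable_cong] = sets
  let ?B = "\<lambda>x \<zeta>::complex. ennreal (log_kernel (x - ln (norm \<zeta>)) 0)"
  have "(\<integral>\<^sup>+ x. \<integral>\<^sup>+ \<zeta>. ?B x \<zeta> \<partial>\<mu> \<partial>lborel) = (\<integral>\<^sup>+ \<zeta>. \<integral>\<^sup>+ x. ?B x \<zeta> \<partial>lborel \<partial>\<mu>)"
    by (rule Fubini'[symmetric]) measurable
  also have "\<dots> = ennreal (pi\<^sup>2 / 2) * emeasure \<mu> (space \<mu>)"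
    by (simp add: nn_integral_log_kernel_shift)
  also have "\<dots> \<noteq> \<infinity>"
    by (simp add: ennreal_mult_eq_top_iff emeasure_eq_measure)
  finally have "AE x in lborel. (\<integral>\<^sup>+ \<zeta>. ?B x \<zeta> \<partial>\<mu>) \<noteq> \<infinity>"
    by (intro nn_integral_PInf_AE) measurable
  with AE_norm_ne_exp[OF sf sets] show ?thesis
  proof eventually_elim
    case (elim x)
    show ?case
    proof
      fix t
      have "(\<integral>\<^sup>+ \<zeta>. ennreal (polar_kernel t x \<zeta>) \<partial>\<mu>) \<le> (\<integral>\<^sup>+ \<zeta>. ?B x \<zeta> \<partial>\<mu>)"
        by (intro nn_integral_mono_AE eventually_mono[OF elim(1)] ennreal_leI polar_kernel_le)
      thus "integrable \<mu> (polar_kernel t x)"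
        using elim(2) by (intro integrableI_nonneg) (auto simp: polar_kernel_nonneg less_top)
    qed
  qed
qed

section \<open>Quadratic moments of the argument\<close>

lemma integrable_sector_moment:
  assumes "finite_measure \<mu>" and "sets \<mu> = sets borel" and "\<bar>t\<bar> \<le> pi"
  shows "integrable \<mu> (\<lambda>\<zeta>. indicator (- {0}) \<zeta> * ((pi - \<bar>Arg \<zeta> - t\<bar>)\<^sup>2 / 2))"
proof (rule finite_measure.integrable_const_bound[where B = "pi\<^sup>2 / 2"])
  show "finite_measure \<mu>" by fact
  note [measurable_cong] = assms(2)
  show "(\<lambda>\<zeta>. indicator (- {0}) \<zeta> * ((pi - \<bar>Arg \<zeta> - t\<bar>)\<^sup>2 / 2)) \<in> borel_measurable \<mu>"
    by measurable
  show "AE \<zeta> in \<mu>. norm (indicator (- {0}) \<zeta> * ((pi - \<bar>Arg \<zeta> - t\<bar>)\<^sup>2 / 2)) \<le> pi\<^sup>2 / 2"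
  proof (rule AE_I2)
    fix \<zeta> :: complex
    have "\<bar>pi - \<bar>Arg \<zeta> - t\<bar>\<bar> \<le> \<bar>pi\<bar>" using Arg_bounded[of \<zeta>] assms(3) by linarith
    hence "(pi - \<bar>Arg \<zeta> - t\<bar>)\<^sup>2 \<le> pi\<^sup>2" by (simp only: abs_le_square_iff)
    thus "norm (indicator (- {0}) \<zeta> * ((pi - \<bar>Arg \<zeta> - t\<bar>)\<^sup>2 / 2)) \<le> pi\<^sup>2 / 2"
      by (simp add: indicator_def)
  qed
qed

text \<open>On almost every circle the radial parts of the two potentials cancel, and the minus sign
  before the kernel reverses the inequality. Integrating over \<open>x\<close> and exchanging
  integrals turns the kernels into quadratic moments.\<close>

lemma sector_moment_le:
  assumes fin: "finite_measure \<mu>" and sets: "sets \<mu> = sets borel"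
    and pot: "\<And>z. potential \<mu> z \<le> potential \<mu> (of_real (norm z))"
    and t: "\<bar>t\<bar> \<le> pi"
  shows "(\<integral>\<zeta>. indicator (- {0}) \<zeta> * ((pi - \<bar>Arg \<zeta>\<bar>)\<^sup>2 / 2) \<partial>\<mu>)
    \<le> (\<integral>\<zeta>. indicator (- {0}) \<zeta> * ((pi - \<bar>Arg \<zeta> - t\<bar>)\<^sup>2 / 2) \<partial>\<mu>)"
proof -
  interpret finite_measure \<mu> by fact
  interpret pair_sigma_finite lborel \<mu> ..
  have sf: "sigma_finite_measure \<mu>" by unfold_locales
  note [measurable_cong] = sets
  have le: "AE x in lborel. (\<integral>\<^sup>+ \<zeta>. polar_kernel 0 x \<zeta> \<partial>\<mu>) \<le> (\<integral>\<^sup>+ \<zeta>. polar_kernel t x \<zeta> \<partial>\<mu>)"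
    using AE_norm_ne_exp[OF sf sets] AE_integrable_polar_kernel[OF fin sets]
  proof eventually_elim
    case (elim x)
    hence int: "integrable \<mu> (polar_kernel s x)" for s by blast
    have "potential \<mu> (of_real (exp x) * cis t) \<le> potential \<mu> (of_real (exp x) * cis 0)"
      using pot[of "of_real (exp x) * cis t"] by (simp add: norm_mult)
    hence "integral\<^sup>L \<mu> (polar_kernel 0 x) \<le> integral\<^sup>L \<mu> (polar_kernel t x)"
      by (simp only: potential_polar[OF fin sets elim(1) int]) simp
    thus ?case by (simp add: nn_integral_eq_integral int polar_kernel_nonneg)
  qed
  have nn: "(\<integral>\<^sup>+ x. \<integral>\<^sup>+ \<zeta>. polar_kernel s x \<zeta> \<partial>\<mu> \<partial>lborel)
      = ennreal (\<integral>\<zeta>. indicator (- {0}) \<zeta> * ((pi - \<bar>Arg \<zeta> - s\<bar>)\<^sup>2 / 2) \<partial>\<mu>)" if "\<bar>s\<bar> \<le> pi" for s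
  proof -
    have "(\<integral>\<^sup>+ x. \<integral>\<^sup>+ \<zeta>. polar_kernel s x \<zeta> \<partial>\<mu> \<partial>lborel) = (\<integral>\<^sup>+ \<zeta>. \<integral>\<^sup>+ x. polar_kernel s x \<zeta> \<partial>lborel \<partial>\<mu>)"
      by (rule Fubini'[symmetric]) measurable
    also have "\<dots> = (\<integral>\<^sup>+ \<zeta>. ennreal (indicator (- {0}) \<zeta> * ((pi - \<bar>Arg \<zeta> - s\<bar>)\<^sup>2 / 2)) \<partial>\<mu>)"
      by (intro nn_integral_cong nn_integral_polar_kernel that)
    also have "\<dots> = ennreal (\<integral>\<zeta>. indicator (- {0}) \<zeta> * ((pi - \<bar>Arg \<zeta> - s\<bar>)\<^sup>2 / 2) \<partial>\<mu>)"
      by (intro nn_integral_eq_integral integrable_sector_moment[OF fin sets that] AE_I2) simp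
    finally show ?thesis .
  qed
  have "ennreal (\<integral>\<zeta>. indicator (- {0}) \<zeta> * ((pi - \<bar>Arg \<zeta> - 0\<bar>)\<^sup>2 / 2) \<partial>\<mu>)
      \<le> ennreal (\<integral>\<zeta>. indicator (- {0}) \<zeta> * ((pi - \<bar>Arg \<zeta> - t\<bar>)\<^sup>2 / 2) \<partial>\<mu>)"
    unfolding nn[OF t, symmetric] by (subst nn[symmetric]) (use le in \<open>auto intro: nn_integral_mono_AE\<close>)
  thus ?thesis by (subst (asm) ennreal_le_iff) (auto intro!: integral_nonneg_AE)
qed

section \<open>Second difference and the sector estimate\<close>

text \<open>The quadratic terms leave \<open>a\<^sup>2\<close>; the linear ones leave a second
  difference of the absolute value, which equals \<open>2 * max 0 (a - \<bar>p\<bar>)\<close> and is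
  at least \<open>a\<close> when \<open>\<bar>p\<bar> \<le> a / 2\<close>.\<close>

lemma sector_second_difference_le:
  assumes "0 \<le> a" and p: "\<bar>p\<bar> \<le> pi"
  shows "(pi - \<bar>p - a\<bar>)\<^sup>2 / 2 + (pi - \<bar>p + a\<bar>)\<^sup>2 / 2 - (pi - \<bar>p\<bar>)\<^sup>2
    \<le> a\<^sup>2 - pi * a * indicator {..a / 2} \<bar>p\<bar>"
proof -
  have "(pi - \<bar>p - a\<bar>)\<^sup>2 / 2 + (pi - \<bar>p + a\<bar>)\<^sup>2 / 2 - (pi - \<bar>p\<bar>)\<^sup>2
      = a\<^sup>2 - pi * (\<bar>p - a\<bar> + \<bar>p + a\<bar> - 2 * \<bar>p\<bar>)"
    by (simp add: power2_diff) (simp add: power2_eq_square field_simps)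
  moreover have "a * indicator {..a / 2} \<bar>p\<bar> \<le> \<bar>p - a\<bar> + \<bar>p + a\<bar> - 2 * \<bar>p\<bar>"
    using assms by (auto simp: indicator_def)
  hence "pi * (a * indicator {..a / 2} \<bar>p\<bar>) \<le> pi * (\<bar>p - a\<bar> + \<bar>p + a\<bar> - 2 * \<bar>p\<bar>)"
    by (intro mult_left_mono) auto
  ultimately show ?thesis by (simp add: mult.assoc)
qed

theorem mainTheorem2:
  fixes \<mu> :: "complex measure" and \<alpha> :: real
  assumes "prob_space \<mu>"
    and "sets \<mu> = sets borel"
    and "\<And>E. E \<in> sets borel \<Longrightarrow> emeasure \<mu> E = emeasure \<mu> (cnj ` E)"
    and "\<And>z. potential \<mu> z \<le> potential \<mu> (complex_of_real (norm z))"
    and "0 < \<alpha>" and "\<alpha> < pi / 2"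
  shows "measure \<mu> {z. z \<noteq> 0 \<and> \<bar>Arg z\<bar> \<le> \<alpha>} \<le> 2 * \<alpha> / pi"
proof -
  interpret prob_space \<mu> by fact
  note sets = assms(2)
  note [measurable_cong] = sets
  \<comment> \<open>Doubling makes the sector the set where the second difference is at least
    \<open>a\<close>; \<alpha> < pi / 2 keeps the rotations by \<open>a\<close> and
    \<open>- a\<close> admissible in \<open>sector_moment_le\<close>.\<close>
  define a where "a = 2 * \<alpha>"
  have a: "0 < a" "a < pi" using assms(5,6) by (auto simp: a_def)
  let ?S = "{z::complex. z \<noteq> 0 \<and> \<bar>Arg z\<bar> \<le> \<alpha>}"
  have S[measurable]: "?S \<in> sets \<mu>" unfolding sets by measurable
  define h where "h = (\<lambda>t \<zeta>. indicator (- {0}) \<zeta> * ((pi - \<bar>Arg \<zeta> - t\<bar>)\<^sup>2 / 2))"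
  have h: "integrable \<mu> (h t)" if "\<bar>t\<bar> \<le> pi" for t
    unfolding h_def using that by (intro integrable_sector_moment sets) unfold_locales
  have "integral\<^sup>L \<mu> (h 0) \<le> integral\<^sup>L \<mu> (h t)" if "\<bar>t\<bar> \<le> pi" for t
    using sector_moment_le[OF finite_measure_axioms sets assms(4) that] by (simp add: h_def)
  \<comment> \<open>Adding the inequalities for opposite rotations produces a second difference of
    moments.\<close>
  from this[of a] this[of "- a"]
  have "0 \<le> integral\<^sup>L \<mu> (h a) + integral\<^sup>L \<mu> (h (- a)) - 2 * integral\<^sup>L \<mu> (h 0)"
    using a by simp
  also have "\<dots> = (\<integral>\<zeta>. h a \<zeta> + h (- a) \<zeta> - 2 * h 0 \<zeta> \<partial>\<mu>)"
    using a by (simp add: h)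
  also have "\<dots> \<le> (\<integral>\<zeta>. a\<^sup>2 - pi * a * indicator ?S \<zeta> \<partial>\<mu>)"
  proof (rule integral_mono)
    show "integrable \<mu> (\<lambda>\<zeta>. h a \<zeta> + h (- a) \<zeta> - 2 * h 0 \<zeta>)" using a by (simp add: h)
    show "integrable \<mu> (\<lambda>\<zeta>. a\<^sup>2 - pi * a * indicator ?S \<zeta>)"
      using S by (simp add: emeasure_eq_measure)
    fix \<zeta>
    have "\<bar>Arg \<zeta>\<bar> \<le> pi" using Arg_bounded[of \<zeta>] by linarith
    \<comment> \<open>At the origin \<open>h\<close> and the indicator vanish, and the bound is
      \<open>0 \<le> a\<^sup>2\<close>.\<close>
    from sector_second_difference_le[OF _ this, of a]
    show "h a \<zeta> + h (- a) \<zeta> - 2 * h 0 \<zeta> \<le> a\<^sup>2 - pi * a * indicator ?S \<zeta>"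
      using a by (cases "\<zeta> = 0") (auto simp: h_def a_def indicator_def)
  qed
  also have "\<dots> = a\<^sup>2 - pi * a * measure \<mu> ?S"
    using S by (simp add: emeasure_eq_measure prob_space)
  finally have "a * (pi * measure \<mu> ?S) \<le> a * a"
    by (simp add: power2_eq_square algebra_simps)
  hence "pi * measure \<mu> ?S \<le> a" using a by simp
  thus ?thesis by (simp add: a_def field_simps)
qed

end
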